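(* Every symmetric Minkowski plane $\mathcal{M}=(\mathcal{P},\Lambda,\Sigma_1\cup\Sigma_2)$ satisfies the rectangle axiom (G): if $\{p_1,p_2,p_3,p_4\}$ and $\{q_1,q_2,q_3,q_4\}$ are two concyclic sets of four distinct points each such that $\{p_iq_i\mid 1\le i\le 4\}$ is also concyclic, then the set $\{q_ip_i\mid 1\le i\le 4\}$ is concyclic.
   Context: A hyperbola structure is a triple $\mathcal{M}=(\mathcal{P},\Lambda,\Sigma_1\cup\Sigma_2)$, where $\mathcal{P}$ is a nonempty set (points) and $\Lambda,\Sigma_1,\Sigma_2$ are nonempty sets of subsets of $\mathcal{P}$ with $\Sigma_1\cap\Sigma_2=\emptyset$ (elements of $\Lambda$ are circles, elements of $\Sigma_1\cup\Sigma_2$ are generators), such that: (H1) for each point $p$ and $i\in\{1,2\}$ there is exactly one $G\in\Sigma_i$ with $p\in G$, denoted $[p]_i$; (H2) any $A\in\Sigma_1$ and $B\in\Sigma_2$ meet in exactly one point; (H3) every generator meets every circle in exactly one point; (H4) for any three distinct points $a,b,c$ with $[a]_i\neq[b]_i\neq[c]_i\neq[a]_i$ for $i=1,2$ there is exactly one circle containing $a,b,c$; (H5) some circle contains at least three points. For points $p,q$, $pq$ denotes the unique point of $[p]_1\cap[q]_2$. A set of points is concyclic if it is contained in some circle. For a circle $K$, the circle symmetry $S_K:\mathcal{P}\to\mathcal{P}$ sends $p$ to the unique point $q$ with $pq\in K$ and $qp\in K$. Two distinct circles $K,L$ are orthogonal ($K\perp L$) if $S_K(p)=p$ for every $p\in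 L$. Symmetry axiom (S): for any circles $K,L$ and any point $p\in L\setminus K$, if $S_K(p)\in L$ then $K\perp L$. A symmetric Minkowski plane is a hyperbola structure satisfying (S) (it then also satisfies the touching axiom: for every circle $C$, $a\in C$ and $b\notin C\cup[a]_1\cup[a]_2$ there is exactly one circle $B$ with $b\in B$ and $C\cap B=\{a\}$).
   Formalization: Orthogonality K ⊥ L is taken to mean that S_K maps L into itself, i.e. S_K(L)=L, instead of S_K(p)=p for every p in L; with the pointwise condition the symmetry axiom (S) would have no models. *)

theory Defs
  imports Main
begin

text \<open>
  \<open>gen \<Sigma> p\<close> is the generator $[p]_i$ of the class \<open>\<Sigma>\<close> $= \Sigma_i$ through \<open>p\<close>, and
  \<open>meet \<Sigma>\<^sub>1 \<Sigma>\<^sub>2 p q\<close> is the point $pq$.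
\<close>

definition gen :: "'a set set \<Rightarrow> 'a \<Rightarrow> 'a set" where
  "gen \<Sigma> p = (THE G. G \<in> \<Sigma> \<and> p \<in> G)"

definition meet :: "'a set set \<Rightarrow> 'a set set \<Rightarrow> 'a \<Rightarrow> 'a \<Rightarrow> 'a" where
  "meet \<Sigma>\<^sub>1 \<Sigma>\<^sub>2 p q = (THE x. x \<in> gen \<Sigma>\<^sub>1 p \<inter> gen \<Sigma>\<^sub>2 q)"

locale hyperbola_structure =
  fixes P :: "'a set" and \<Lambda> \<Sigma>\<^sub>1 \<Sigma>\<^sub>2 :: "'a set set"
  assumes nonempty: "P \<noteq> {}" "\<Lambda> \<noteq> {}" "\<Sigma>\<^sub>1 \<noteq> {}" "\<Sigma>\<^sub>2 \<noteq> {}"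
    and subsets: "\<Lambda> \<subseteq> Pow P" "\<Sigma>\<^sub>1 \<subseteq> Pow P" "\<Sigma>\<^sub>2 \<subseteq> Pow P"
    and disjoint: "\<Sigma>\<^sub>1 \<inter> \<Sigma>\<^sub>2 = {}"
    and H1: "\<And>p \<Sigma>. p \<in> P \<Longrightarrow> \<Sigma> \<in> {\<Sigma>\<^sub>1, \<Sigma>\<^sub>2} \<Longrightarrow> \<exists>!G. G \<in> \<Sigma> \<and> p \<in> G"
    and H2: "\<And>A B. A \<in> \<Sigma>\<^sub>1 \<Longrightarrow> B \<in> \<Sigma>\<^sub>2 \<Longrightarrow> \<exists>!x. x \<in> A \<inter> B"
    and H3: "\<And>G K. G \<in> \<Sigma>\<^sub>1 \<union> \<Sigma>\<^sub>2 \<Longrightarrow> K \<in> \<Lambda> \<Longrightarrow> \<exists>!x. x \<in> G \<inter> K"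
    and H4: "\<And>a b c. a \<in> P \<Longrightarrow> b \<in> P \<Longrightarrow> c \<in> P \<Longrightarrow> distinct [a, b, c] \<Longrightarrow>
              (\<And>\<Sigma>. \<Sigma> \<in> {\<Sigma>\<^sub>1, \<Sigma>\<^sub>2} \<Longrightarrow> distinct [gen \<Sigma> a, gen \<Sigma> b, gen \<Sigma> c]) \<Longrightarrow>
              \<exists>!K. K \<in> \<Lambda> \<and> {a, b, c} \<subseteq> K"
    and H5: "\<exists>K\<in>\<Lambda>. \<exists>a b c. distinct [a, b, c] \<and> {a, b, c} \<subseteq> K"
begin

abbreviation point_prod :: "'a \<Rightarrow> 'a \<Rightarrow> 'a" (infixl "\<diamondop>" 70) where
  "p \<diamondop> q \<equiv> meet \<Sigma>\<^sub>1 \<Sigma>\<^sub>2 p q"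

definition concyclic :: "'a set \<Rightarrow> bool" where
  "concyclic A \<longleftrightarrow> (\<exists>K\<in>\<Lambda>. A \<subseteq> K)"

definition circle_symmetry :: "'a set \<Rightarrow> 'a \<Rightarrow> 'a" where
  "circle_symmetry K p = (THE q. q \<in> P \<and> p \<diamondop> q \<in> K \<and> q \<diamondop> p \<in> K)"

text \<open>
  Orthogonality means that the reflection in \<open>K\<close> leaves \<open>L\<close> invariant as a set, i.e. $S_K(L) = L$
  (see \<open>orthogonal_iff_image\<close> below). It is not pointwise invariance: $S_K(p) = p$ holds only for
  \<open>p \<in> K\<close> (see \<open>circle_symmetry_fixed_iff\<close>), so pointwise invariance would force \<open>L \<subseteq> K\<close>, and with
  it the symmetry axiom would have no model (see \<open>pointwise_symmetry_axiom_inconsistent\<close>).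
\<close>

definition orthogonal :: "'a set \<Rightarrow> 'a set \<Rightarrow> bool" (infix "\<bottom>\<bottom>" 50) where
  "K \<bottom>\<bottom> L \<longleftrightarrow> K \<in> \<Lambda> \<and> L \<in> \<Lambda> \<and> K \<noteq> L \<and> (\<forall>p\<in>L. circle_symmetry K p \<in> L)"

definition rectangle_axiom :: bool where
  "rectangle_axiom \<longleftrightarrow>
    (\<forall>p q :: nat \<Rightarrow> 'a.
       p ` {1..4} \<subseteq> P \<and> q ` {1..4} \<subseteq> P \<and>
       inj_on p {1..4} \<and> inj_on q {1..4} \<and>
       concyclic (p ` {1..4}) \<and> concyclic (q ` {1..4}) \<and>
       concyclic ((\<lambda>i. p i \<diamondop> q i) ` {1..4}) \<longrightarrow>
       concyclic ((\<lambda>i. q i \<diamondop> p i) ` {1..4}))"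

lemma gen1: assumes "p \<in> P" shows "gen \<Sigma>\<^sub>1 p \<in> \<Sigma>\<^sub>1" "p \<in> gen \<Sigma>\<^sub>1 p"
  using theI'[OF H1[OF assms, of \<Sigma>\<^sub>1]] by (simp_all add: gen_def)

lemma gen2: assumes "p \<in> P" shows "gen \<Sigma>\<^sub>2 p \<in> \<Sigma>\<^sub>2" "p \<in> gen \<Sigma>\<^sub>2 p"
  using theI'[OF H1[OF assms, of \<Sigma>\<^sub>2]] by (simp_all add: gen_def)

lemma gen1_eq: assumes "p \<in> P" "G \<in> \<Sigma>\<^sub>1" "p \<in> G" shows "gen \<Sigma>\<^sub>1 p = G"
  using H1[OF assms(1), of \<Sigma>\<^sub>1] gen1[OF assms(1)] assms by blast

lemma gen2_eq: assumes "p \<in> P" "G \<in> \<Sigma>\<^sub>2" "p \<in> G" shows "gen \<Sigma>\<^sub>2 p = G"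
  using H1[OF assms(1), of \<Sigma>\<^sub>2] gen2[OF assms(1)] assms by blast

lemma meet_gen:
  assumes "p \<in> P" "q \<in> P"
  shows "p \<diamondop> q \<in> P" "gen \<Sigma>\<^sub>1 (p \<diamondop> q) = gen \<Sigma>\<^sub>1 p" "gen \<Sigma>\<^sub>2 (p \<diamondop> q) = gen \<Sigma>\<^sub>2 q"
proof -
  have *: "p \<diamondop> q \<in> gen \<Sigma>\<^sub>1 p \<inter> gen \<Sigma>\<^sub>2 q"
    unfolding meet_def using H2[OF gen1(1)[OF assms(1)] gen2(1)[OF assms(2)]] by (rule theI')
  then show P: "p \<diamondop> q \<in> P" using gen1(1)[OF assms(1)] subsets by blast
  show "gen \<Sigma>\<^sub>1 (p \<diamondop> q) = gen \<Sigma>\<^sub>1 p" using * gen1_eq[OF P gen1(1)[OF assms(1)]] by blast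
  show "gen \<Sigma>\<^sub>2 (p \<diamondop> q) = gen \<Sigma>\<^sub>2 q" using * gen2_eq[OF P gen2(1)[OF assms(2)]] by blast
qed

lemma point_eqI:
  assumes "p \<in> P" "q \<in> P" "gen \<Sigma>\<^sub>1 p = gen \<Sigma>\<^sub>1 q" "gen \<Sigma>\<^sub>2 p = gen \<Sigma>\<^sub>2 q"
  shows "p = q"
  using H2[OF gen1(1)[OF assms(1)] gen2(1)[OF assms(1)]]
    gen1(2)[OF assms(1)] gen1(2)[OF assms(2)] gen2(2)[OF assms(1)] gen2(2)[OF assms(2)] assms(3,4)
  by auto

lemma circle_eqI:
  assumes "K \<in> \<Lambda>" "p \<in> K" "q \<in> K" "gen \<Sigma>\<^sub>1 p = gen \<Sigma>\<^sub>1 q \<or> gen \<Sigma>\<^sub>2 p = gen \<Sigma>\<^sub>2 q"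
  shows "p = q"
proof -
  have P: "p \<in> P" "q \<in> P" using assms subsets by auto
  show ?thesis
    using assms(4)
  proof
    assume "gen \<Sigma>\<^sub>1 p = gen \<Sigma>\<^sub>1 q"
    then show ?thesis using H3[of "gen \<Sigma>\<^sub>1 p" K] gen1[OF P(1)] gen1[OF P(2)] assms by auto
  next
    assume "gen \<Sigma>\<^sub>2 p = gen \<Sigma>\<^sub>2 q"
    then show ?thesis using H3[of "gen \<Sigma>\<^sub>2 p" K] gen2[OF P(1)] gen2[OF P(2)] assms by auto
  qed
qed

lemma meet_self: "p \<in> P \<Longrightarrow> p \<diamondop> p = p"
  by (rule point_eqI) (simp_all add: meet_gen)

lemma circle_symmetry_ex1:
  assumes K: "K \<in> \<Lambda>" and p: "p \<in> P"
  shows "\<exists>!q. q \<in> P \<and> p \<diamondop> q \<in> K \<and> q \<diamondop> p \<in> K"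
proof -
  obtain a where a: "a \<in> gen \<Sigma>\<^sub>1 p" "a \<in> K" using H3[of "gen \<Sigma>\<^sub>1 p" K] gen1[OF p] K by auto
  obtain b where b: "b \<in> gen \<Sigma>\<^sub>2 p" "b \<in> K" using H3[of "gen \<Sigma>\<^sub>2 p" K] gen2[OF p] K by auto
  have P: "a \<in> P" "b \<in> P" using a b K subsets by auto
  have ga: "gen \<Sigma>\<^sub>1 a = gen \<Sigma>\<^sub>1 p" using gen1_eq[OF P(1) gen1(1)[OF p] a(1)] .
  have gb: "gen \<Sigma>\<^sub>2 b = gen \<Sigma>\<^sub>2 p" using gen2_eq[OF P(2) gen2(1)[OF p] b(1)] .
  have 1: "p \<diamondop> (b \<diamondop> a) = a" by (rule point_eqI) (simp_all add: meet_gen P p ga)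
  have 2: "(b \<diamondop> a) \<diamondop> p = b" by (rule point_eqI) (simp_all add: meet_gen P p gb)
  show ?thesis
  proof (rule ex1I[of _ "b \<diamondop> a"])
    show "b \<diamondop> a \<in> P \<and> p \<diamondop> (b \<diamondop> a) \<in> K \<and> (b \<diamondop> a) \<diamondop> p \<in> K"
      using 1 2 a b meet_gen P by simp
  next
    fix q assume q: "q \<in> P \<and> p \<diamondop> q \<in> K \<and> q \<diamondop> p \<in> K"
    then have "p \<diamondop> q = a" "q \<diamondop> p = b"
      using circle_eqI[OF K _ a(2)] circle_eqI[OF K _ b(2)] ga gb meet_gen p by auto
    then have "gen \<Sigma>\<^sub>2 q = gen \<Sigma>\<^sub>2 a" "gen \<Sigma>\<^sub>1 q = gen \<Sigma>\<^sub>1 b" using meet_gen q p by metis+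
    then show "q = b \<diamondop> a" using point_eqI q meet_gen P by metis
  qed
qed

lemma circle_symmetry:
  assumes "K \<in> \<Lambda>" "p \<in> P"
  shows "circle_symmetry K p \<in> P" "p \<diamondop> circle_symmetry K p \<in> K" "circle_symmetry K p \<diamondop> p \<in> K"
  using theI'[OF circle_symmetry_ex1[OF assms]] by (simp_all add: circle_symmetry_def)

lemma circle_symmetry_eqI:
  assumes "K \<in> \<Lambda>" "p \<in> P" "q \<in> P" "p \<diamondop> q \<in> K" "q \<diamondop> p \<in> K"
  shows "circle_symmetry K p = q"
  using circle_symmetry_ex1[OF assms(1,2)] circle_symmetry[OF assms(1,2)] assms(3-) by blast

lemma circle_symmetry_involution:
  assumes "K \<in> \<Lambda>" "p \<in> P"
  shows "circle_symmetry K (circle_symmetry K p) = p"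
  using circle_symmetry[OF assms] assms by (intro circle_symmetry_eqI)

lemma circle_symmetry_fixed_iff:
  assumes "K \<in> \<Lambda>" "p \<in> P"
  shows "circle_symmetry K p = p \<longleftrightarrow> p \<in> K"
  using circle_symmetry[OF assms] circle_symmetry_eqI[OF assms assms(2)] meet_self[OF assms(2)]
  by auto

lemma orthogonal_iff_image:
  assumes "K \<in> \<Lambda>" "L \<in> \<Lambda>"
  shows "K \<bottom>\<bottom> L \<longleftrightarrow> K \<noteq> L \<and> circle_symmetry K ` L = L"
proof -
  have "L \<subseteq> circle_symmetry K ` L" if *: "\<forall>p\<in>L. circle_symmetry K p \<in> L"
  proof
    fix p assume "p \<in> L"
    then have "p \<in> P" using assms(2) subsets(1) by blast
    then have "p = circle_symmetry K (circle_symmetry K p)"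
      using circle_symmetry_involution[OF assms(1)] by simp
    then show "p \<in> circle_symmetry K ` L" using * \<open>p \<in> L\<close> by blast
  qed
  then show ?thesis using assms unfolding orthogonal_def by blast
qed

lemma pointwise_symmetry_axiom_inconsistent:
  assumes "\<And>K L p. K \<in> \<Lambda> \<Longrightarrow> L \<in> \<Lambda> \<Longrightarrow> p \<in> L - K \<Longrightarrow> circle_symmetry K p \<in> L \<Longrightarrow>
             K \<noteq> L \<and> (\<forall>p\<in>L. circle_symmetry K p = p)"
  shows False
proof -
  obtain K a b c where K: "K \<in> \<Lambda>" "distinct [a, b, c]" "{a, b, c} \<subseteq> K" using H5 by blast
  then have P: "a \<in> P" "b \<in> P" "c \<in> P" using subsets by auto
  have d: "distinct [gen \<Sigma>\<^sub>1 a, gen \<Sigma>\<^sub>1 b, gen \<Sigma>\<^sub>1 c]" "distinct [gen \<Sigma>\<^sub>2 a, gen \<Sigma>\<^sub>2 b, gen \<Sigma>\<^sub>2 c]"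
    using K(2,3) circle_eqI[OF K(1), of a b] circle_eqI[OF K(1), of a c] circle_eqI[OF K(1), of b c]
    by auto
  define p where "p = a \<diamondop> b"
  define q where "q = b \<diamondop> a"
  have pq: "p \<in> P" "q \<in> P" "gen \<Sigma>\<^sub>1 p = gen \<Sigma>\<^sub>1 a" "gen \<Sigma>\<^sub>2 p = gen \<Sigma>\<^sub>2 b"
      "gen \<Sigma>\<^sub>1 q = gen \<Sigma>\<^sub>1 b" "gen \<Sigma>\<^sub>2 q = gen \<Sigma>\<^sub>2 a"
    unfolding p_def q_def using P meet_gen by simp_all
  have "p \<diamondop> q = a" "q \<diamondop> p = b" by (rule point_eqI; simp add: meet_gen P pq)+
  then have S: "circle_symmetry K p = q"
    using K(3) circle_symmetry_eqI[OF K(1) pq(1,2)] by simp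
  have d': "distinct [gen \<Sigma>\<^sub>1 p, gen \<Sigma>\<^sub>1 q, gen \<Sigma>\<^sub>1 c]" "distinct [gen \<Sigma>\<^sub>2 p, gen \<Sigma>\<^sub>2 q, gen \<Sigma>\<^sub>2 c]"
    unfolding pq(3-) using d by auto
  then have dp: "distinct [p, q, c]" by force
  have dg: "distinct [gen \<Sigma> p, gen \<Sigma> q, gen \<Sigma> c]" if "\<Sigma> \<in> {\<Sigma>\<^sub>1, \<Sigma>\<^sub>2}" for \<Sigma>
    using that d' by blast
  obtain L where L: "L \<in> \<Lambda>" "{p, q, c} \<subseteq> L"
    using ex1_implies_ex[OF H4[OF pq(1,2) P(3) dp dg]] by blast
  have "p \<notin> K" using circle_symmetry_fixed_iff[OF K(1) pq(1)] S d(1) pq(3,5) by auto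
  then show False using assms[OF K(1) L(1), of p] L(2) S d(1) pq(3,5) by auto
qed

end

locale symmetric_minkowski_plane = hyperbola_structure +
  assumes symmetry_axiom:
    "\<And>K L p. K \<in> \<Lambda> \<Longrightarrow> L \<in> \<Lambda> \<Longrightarrow> p \<in> L - K \<Longrightarrow> circle_symmetry K p \<in> L \<Longrightarrow> K \<bottom>\<bottom> L"

end

theory Submission
  imports Defs "HOL-Combinatorics.Permutations"
begin

text \<open>
  Identifying the two classes of generators along a circle turns the circles into a sharply
  3-transitive set \<open>\<Gamma>\<close> of permutations of \<open>\<Sigma>\<^sub>1\<close>, and the rectangle axiom says that
  \<open>f \<circ> h\<^sup>-\<^sup>1 \<circ> g \<in> \<Gamma>\<close> for all \<open>f, g, h \<in> \<Gamma>\<close>. The symmetry axiom says that \<open>k\<^sup>-\<^sup>1 \<circ> f\<close> is an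
  involution as soon as it exchanges two elements. For fixed \<open>a, b\<close> the quotients \<open>h\<^sup>-\<^sup>1 \<circ> f\<close> of
  circles in the pencil \<open>a \<mapsto> p, b \<mapsto> q\<close> therefore form an abelian group \<open>A(p,q)\<close>, sharply
  transitive on the remaining elements. Its members are the ratios \<open>C\<^sub>r\<^sup>-\<^sup>1 \<circ> C\<^sub>s\<close>, where \<open>C\<^sub>r\<close> is the
  circle of the pencil sending a third element to \<open>r\<close>. This ratio behaves like a cross ratio: it is
  symmetric under \<open>(p,q) \<leftrightarrow> (r,s)\<close> and multiplicative in each pair. An Eckmann-Hilton argument then
  shows that \<open>A(p,q)\<close> and \<open>A(p,u)\<close> commute, hence coincide, so \<open>A(p,q)\<close> depends only on \<open>a, b\<close>.
  Thus \<open>f \<circ> h\<^sup>-\<^sup>1 \<circ> g \<in> \<Gamma>\<close> whenever \<open>g\<close> and \<open>h\<close> agree at two elements, and any two circles are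
  joined by a chain whose consecutive members agree at two elements.
\<close>

section \<open>Sharply 3-transitive permutation sets with the exchange property\<close>

locale symmetric_permutation_set =
  fixes X :: "'x set" and \<Gamma> :: "('x \<Rightarrow> 'x) set"
  assumes permutes: "f \<in> \<Gamma> \<Longrightarrow> f permutes X"
    and sharp: "\<lbrakk>{a, b, c} \<subseteq> X; distinct [a, b, c]; {p, q, r} \<subseteq> X; distinct [p, q, r]\<rbrakk>
      \<Longrightarrow> \<exists>!f. f \<in> \<Gamma> \<and> f a = p \<and> f b = q \<and> f c = r"
    and swap: "\<lbrakk>f \<in> \<Gamma>; k \<in> \<Gamma>; a \<in> X; b \<in> X; a \<noteq> b; f a = k b; f b = k a; x \<in> X; y \<in> X; f x = k y\<rbrakk>
      \<Longrightarrow> f y = k x"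
begin

lemma in_X [simp]: "f \<in> \<Gamma> \<Longrightarrow> f x \<in> X \<longleftrightarrow> x \<in> X"
  using permutes permutes_in_image by metis

lemma inv_in_X [simp]: "f \<in> \<Gamma> \<Longrightarrow> inv f x \<in> X \<longleftrightarrow> x \<in> X"
  using permutes permutes_inv permutes_in_image by metis

lemma inv_apply [simp]: "f \<in> \<Gamma> \<Longrightarrow> inv f (f x) = x" "f \<in> \<Gamma> \<Longrightarrow> f (inv f x) = x"
  using permutes permutes_inverses by metis+

lemma apply_eq_iff [simp]: "f \<in> \<Gamma> \<Longrightarrow> f x = f y \<longleftrightarrow> x = y"
  using inv_apply(1) by metis

lemma inv_apply_eq_iff [simp]: "f \<in> \<Gamma> \<Longrightarrow> inv f x = inv f y \<longleftrightarrow> x = y"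
  using inv_apply(2) by metis

lemma inv_eq: "f \<in> \<Gamma> \<Longrightarrow> inv f y = x \<longleftrightarrow> y = f x"
  using inv_apply by metis

lemma outside: "f \<in> \<Gamma> \<Longrightarrow> x \<notin> X \<Longrightarrow> f x = x" "f \<in> \<Gamma> \<Longrightarrow> x \<notin> X \<Longrightarrow> inv f x = x"
  using permutes permutes_not_in permutes_inv by metis+

lemma comp_inv [simp]:
  assumes "f \<in> \<Gamma>" shows "inv f \<circ> (f \<circ> g) = g" "f \<circ> (inv f \<circ> g) = g"
  using assms by (auto simp: fun_eq_iff)

lemma agree_eq:
  assumes "f \<in> \<Gamma>" "g \<in> \<Gamma>" "{a, b, c} \<subseteq> X" "distinct [a, b, c]" "f a = g a" "f b = g b" "f c = g c"
  shows "f = g"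
proof -
  have "distinct [f a, f b, f c]" "{f a, f b, f c} \<subseteq> X" using assms by auto
  then show ?thesis using sharp[OF assms(3,4), of "f a" "f b" "f c"] assms by metis
qed

text \<open>Since \<open>card\<close> is 0 on infinite sets, having more than \<open>n\<close>
  elements is expressed by \<open>\<not> (finite X \<and> card X \<le> n)\<close>, here and
  below.\<close>

lemma avoid:
  assumes "\<not> (finite X \<and> card X \<le> n)" "length xs \<le> n"
  shows "\<exists>x\<in>X. x \<notin> set xs"
proof (rule ccontr)
  assume "\<not> ?thesis"
  then have sub: "X \<subseteq> set xs" by auto
  then have "card X \<le> length xs"
    using card_mono[OF _ sub] card_length[of xs] by simp
  then show False using assms finite_subset[OF sub] by simp
qed

text \<open>In the plane these are the circles through the two points with coordinates
  \<open>(a, p)\<close> and \<open>(b, q)\<close>.\<close>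

definition pencil :: "'x \<Rightarrow> 'x \<Rightarrow> 'x \<Rightarrow> 'x \<Rightarrow> ('x \<Rightarrow> 'x) set" where
  "pencil a b p q = {f \<in> \<Gamma>. f a = p \<and> f b = q}"

lemma pencilD: "f \<in> pencil a b p q \<Longrightarrow> f \<in> \<Gamma>" "f \<in> pencil a b p q \<Longrightarrow> f a = p"
  "f \<in> pencil a b p q \<Longrightarrow> f b = q"
  by (auto simp: pencil_def)

lemma pencil_flip: "pencil a b p q = pencil b a q p"
  by (auto simp: pencil_def)

end

section \<open>Pencils and composition within one pencil\<close>

locale frame = symmetric_permutation_set +
  fixes a b c :: 'a
  assumes frame: "a \<in> X" "b \<in> X" "c \<in> X" "distinct [a, b, c]"
begin

abbreviation "L p q \<equiv> pencil a b p q"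

lemma pencil_in:
  assumes "f \<in> L p q" "x \<in> X - {a, b}"
  shows "f x \<in> X - {p, q}"
  using assms by (auto simp: pencil_def)

lemma pencil_inv_in:
  assumes "f \<in> L p q" "y \<in> X - {p, q}"
  shows "inv f y \<in> X - {a, b}"
  using assms by (auto simp: pencil_def inv_eq)

lemma pencil_agree:
  assumes "f \<in> L p q" "g \<in> L p q" "x \<notin> X - {a, b}"
  shows "f x = g x"
proof -
  consider "x \<notin> X" | "x = a" | "x = b" using assms(3) by auto
  then show ?thesis
    using assms(1,2) by cases (simp_all add: outside(1) pencil_def)
qed

lemma pencil_transitive:
  assumes "x \<in> X - {a, b}" "y \<in> X - {p, q}" "{p, q} \<subseteq> X" "p \<noteq> q"
  obtains f where "f \<in> L p q" "f x = y"
proof -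
  have "\<exists>!f. f \<in> \<Gamma> \<and> f a = p \<and> f b = q \<and> f x = y"
    using assms frame by (intro sharp) auto
  then show ?thesis using that by (auto simp: pencil_def)
qed

lemma pencil_eqI:
  assumes "f \<in> L p q" "g \<in> L p q" "x \<in> X - {a, b}" "f x = g x"
  shows "f = g"
  using assms frame by (intro agree_eq[of f g a b x]) (auto simp: pencil_def)

text \<open>
  Circles of the pencils \<open>L p q\<close> and \<open>L q p\<close> are orthogonal: this is where the symmetry axiom enters.
\<close>

lemma opposite:
  assumes "f \<in> L p q" "k \<in> L q p" "x \<in> X" "y \<in> X" "f x = k y"
  shows "f y = k x"
  using swap[of f k a b x y] assms frame by (simp add: pencil_def)

lemma pencil_carrier:
  assumes "f \<in> L p q" shows "p \<in> X" "q \<in> X" "p \<noteq> q"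
  using assms frame by (auto simp: pencil_def)

text \<open>With \<open>y = inv h (g x)\<close>, take \<open>k\<close> in the opposite pencil with
  \<open>k x = f y\<close>. Applying \<open>opposite\<close> to \<open>f\<close>, \<open>h\<close>
  and \<open>g\<close> in turn, always against \<open>k\<close>, carries one side into the
  other.\<close>

lemma pencil_commute:
  assumes f: "f \<in> L p q" and g: "g \<in> L p q" and h: "h \<in> L p q"
  shows "f (inv h (g x)) = g (inv h (f x))"
proof (cases "x \<in> X - {a, b}")
  case False
  then have "g x = h x" "f x = h x" using assms pencil_agree by metis+
  then show ?thesis using pencilD(1)[OF h] pencil_agree[OF f g False] by simp
next
  case x: True
  define y where "y = inv h (g x)"
  have y: "y \<in> X - {a, b}" unfolding y_def using f g h x pencil_in pencil_inv_in by metis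
  have hy: "h y = g x" unfolding y_def using h pencilD by simp
  obtain k where k: "k \<in> L q p" "k x = f y"
    using pencil_transitive[OF x, of "f y" q p] pencil_in[OF f y] pencil_carrier[OF f] by auto
  have kx: "f x = k y" using opposite[OF f k(1)] x y k(2) by auto
  define z where "z = inv h (f x)"
  have z: "z \<in> X" unfolding z_def using x f h pencilD by auto
  have hz: "h z = f x" unfolding z_def using h pencilD by simp
  have "h y = k z" using opposite[OF h k(1), of z y] hz kx y z by simp
  then have "g z = k x" using opposite[OF g k(1), of x z] hy x z by simp
  then show ?thesis unfolding y_def[symmetric] z_def[symmetric] using k(2) by simp
qed

text \<open>The only candidate is the member \<open>m\<close> with the right value at
  \<open>c\<close>. At any other \<open>x\<close>, write \<open>x = inv h (e c)\<close> with
  \<open>e\<close> in the pencil and move \<open>e\<close> past the other members by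
  \<open>pencil_commute\<close>.\<close>

lemma pencil_closed:
  assumes f: "f \<in> L p q" and g: "g \<in> L p q" and h: "h \<in> L p q"
  shows "f \<circ> (inv h \<circ> g) \<in> L p q"
proof -
  have G: "f \<in> \<Gamma>" "g \<in> \<Gamma>" "h \<in> \<Gamma>" using assms pencilD by auto
  have c: "c \<in> X - {a, b}" using frame by auto
  obtain m where m: "m \<in> L p q" "m c = f (inv h (g c))"
    using pencil_transitive[OF c pencil_in[OF f pencil_inv_in[OF h pencil_in[OF g c]]]]
      pencil_carrier[OF f] by auto
  have "m x = f (inv h (g x))" for x
  proof (cases "x \<in> X - {a, b}")
    case False
    then have "g x = h x" "m x = f x" using f g h m(1) pencil_agree by metis+
    then show ?thesis using G by simp
  next
    case x: True
    obtain e where e: "e \<in> L p q" "e c = h x"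
      using pencil_transitive[OF c pencil_in[OF h x]] pencil_carrier[OF f] by auto
    have x_eq: "x = inv h (e c)" using e G by simp
    have "m x = e (inv h (m c))" unfolding x_eq using pencil_commute[OF m(1) e(1) h] .
    also have "\<dots> = f (inv h (e (inv h (g c))))"
      using m(2) pencil_commute[OF e(1) f h] by simp
    also have "\<dots> = f (inv h (g x))"
      unfolding x_eq using pencil_commute[OF e(1) g h] by simp
    finally show ?thesis .
  qed
  then have "m = f \<circ> (inv h \<circ> g)" by auto
  then show ?thesis using m by simp
qed

section \<open>Ratios and their cross-ratio identities\<close>

definition through :: "'a \<Rightarrow> 'a \<Rightarrow> 'a \<Rightarrow> 'a \<Rightarrow> 'a" where
  "through p q r = (THE f. f \<in> L p q \<and> f c = r)"

definition ratio :: "'a \<Rightarrow> 'a \<Rightarrow> 'a \<Rightarrow> 'a \<Rightarrow> 'a \<Rightarrow> 'a" where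
  "ratio p q r s = inv (through p q r) \<circ> through p q s"

lemma through:
  assumes "{p, q, r} \<subseteq> X" "distinct [p, q, r]"
  shows "through p q r \<in> L p q" "through p q r c = r"
proof -
  have "\<exists>!f. f \<in> \<Gamma> \<and> f a = p \<and> f b = q \<and> f c = r"
    using assms frame by (intro sharp) auto
  then have "\<exists>!f. f \<in> L p q \<and> f c = r" by (simp add: pencil_def)
  from theI'[OF this] show "through p q r \<in> L p q" "through p q r c = r"
    unfolding through_def by auto
qed

text \<open>Commutativity of the pencil, evaluated at \<open>c\<close>, yields the value at
  \<open>inv f r\<close>. As \<open>f\<close> varies, these elements exhaust
  \<open>X - {a, b}\<close>, so the ratio does not depend on the choice of \<open>c\<close>.\<close>

lemma ratio_inv_apply:
  assumes f: "f \<in> L p q" and rs: "r \<in> X - {p, q}" "s \<in> X - {p, q}"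
  shows "ratio p q r s (inv f r) = inv f s"
proof -
  have pq: "p \<in> X" "q \<in> X" "p \<noteq> q" using pencil_carrier[OF f] by auto
  have r: "through p q r \<in> L p q" "through p q r c = r"
    using rs pq by (intro through; auto)+
  have s: "through p q s \<in> L p q" "through p q s c = s"
    using rs pq by (intro through; auto)+
  have "through p q s (inv f r) = through p q r (inv f s)"
    using pencil_commute[OF s(1) r(1) f, of c] r s by simp
  then show ?thesis unfolding ratio_def using r(1) pencilD by simp
qed

lemma ratio_outside:
  assumes "{p, q, r, s} \<subseteq> X" "distinct [p, q, r]" "distinct [p, q, s]" "x \<notin> X - {a, b}"
  shows "ratio p q r s x = x"
proof -
  have "through p q s x = through p q r x" "through p q r \<in> \<Gamma>"
    using through(1)[of p q r] through(1)[of p q s] pencil_agree[OF _ _ assms(4)] pencilD(1) assms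
    by auto
  then show ?thesis by (simp add: ratio_def)
qed

text \<open>Choose \<open>f\<close> in \<open>L p q\<close> with \<open>f z = r\<close> and
  \<open>m\<close> in \<open>L r s\<close> with \<open>m z = p\<close>. Then
  \<open>inv f \<circ> m\<close> exchanges \<open>a\<close> and \<open>z\<close>, so by
  \<open>swap\<close> it also exchanges \<open>b\<close> and \<open>inv f s\<close>. Hence
  \<open>inv f s = inv m q\<close>, and these are the values of the two ratios at
  \<open>z\<close>.\<close>

lemma ratio_symmetric:
  assumes X: "{p, q, r, s} \<subseteq> X" and d: "distinct [p, q, r, s]"
  shows "ratio p q r s = ratio r s p q"
proof
  fix z
  show "ratio p q r s z = ratio r s p q z"
  proof (cases "z \<in> X - {a, b}")
    case False
    then show ?thesis using ratio_outside[of p q r s z] ratio_outside[of r s p q z] assms by auto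
  next
    case z: True
    obtain f where f: "f \<in> L p q" "f z = r"
      using pencil_transitive[OF z, of r p q] X d by auto
    obtain m where m: "m \<in> L r s" "m z = p"
      using pencil_transitive[OF z, of p r s] X d by auto
    have G: "f \<in> \<Gamma>" "m \<in> \<Gamma>" using f m pencilD by auto
    have "m (inv f s) = f b"
      using swap[OF G(2,1), of a z b "inv f s"] f m z G frame X by (auto simp: pencil_def)
    then have y: "inv f s = inv m q" using pencilD(3)[OF f(1)] inv_apply(1)[OF G(2)] by metis
    have z_eq: "inv f r = z" "inv m p = z" using f(2) m(2) G by auto
    have "ratio p q r s z = inv f s"
      using ratio_inv_apply[OF f(1), of r s] X d unfolding z_eq by auto
    moreover have "ratio r s p q z = inv m q"
      using ratio_inv_apply[OF m(1), of p q] X d unfolding z_eq by auto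
    ultimately show ?thesis using y by simp
  qed
qed

lemma ratio_bij:
  assumes "{p, q, r, s} \<subseteq> X" "distinct [p, q, r]" "distinct [p, q, s]"
  shows "bij (ratio p q r s)"
proof -
  have "through p q r permutes X" "through p q s permutes X"
    using through(1)[of p q r] through(1)[of p q s] permutes pencilD(1) assms by auto
  then show ?thesis
    unfolding ratio_def using bij_comp permutes_bij permutes_inv by metis
qed

lemma ratio_trans:
  assumes "{p, q, r, s, t} \<subseteq> X" "distinct [p, q, r]" "distinct [p, q, s]" "distinct [p, q, t]"
  shows "ratio p q r s \<circ> ratio p q s t = ratio p q r t"
proof -
  have "through p q s \<in> \<Gamma>" using through(1)[of p q s] pencilD(1) assms by auto
  then show ?thesis by (simp add: ratio_def comp_assoc)
qed

text \<open>This is \<open>ratio_trans\<close> transported by \<open>ratio_symmetric\<close>. It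
  supplies the second multiplication for the Eckmann-Hilton argument.\<close>

lemma ratio_trans':
  assumes "{p, q, r, s, t} \<subseteq> X" "distinct [p, q, r, s]" "t \<notin> {r, s}" "p \<noteq> t" "q \<noteq> t"
  shows "ratio p q r s \<circ> ratio q t r s = ratio p t r s"
proof -
  have "ratio p q r s = ratio r s p q" "ratio q t r s = ratio r s q t"
    "ratio p t r s = ratio r s p t"
    using assms by (intro ratio_symmetric; auto)+
  moreover have "ratio r s p q \<circ> ratio r s q t = ratio r s p t"
    using assms by (intro ratio_trans) auto
  ultimately show ?thesis by simp
qed

lemma ratio_refl: "\<lbrakk>{p, q, r} \<subseteq> X; distinct [p, q, r]\<rbrakk> \<Longrightarrow> ratio p q r r = id"
  using through(1)[of p q r] pencilD(1) by (auto simp: ratio_def fun_eq_iff)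

section \<open>Commuting quotients, within one pencil and across two\<close>

lemma quotient_commute:
  assumes "f \<in> L p q" "g \<in> L p q" "h \<in> L p q" "k \<in> L p q"
  shows "(inv h \<circ> f) \<circ> (inv k \<circ> g) = (inv k \<circ> g) \<circ> (inv h \<circ> f)"
proof -
  have m: "h \<circ> (inv k \<circ> g) \<in> L p q" (is "?m \<in> _") using assms by (intro pencil_closed)
  have G: "h \<in> \<Gamma>" using assms pencilD by auto
  have "f (inv h (?m x)) = ?m (inv h (f x))" for x
    using pencil_commute[OF assms(1) m assms(3)] .
  then show ?thesis using G by (simp add: fun_eq_iff)
qed

text \<open>Multiplied by \<open>h\<close>, both sides lie in one pencil and agree at
  \<open>x\<close>. The free choice of \<open>x\<close> later keeps the entries \<open>h x\<close>
  and \<open>f x\<close> away from a given element.\<close>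

lemma quotient_eq_ratio:
  assumes f: "f \<in> L p q" and h: "h \<in> L p q" and x: "x \<in> X - {a, b}"
  shows "inv h \<circ> f = ratio p q (h x) (f x)"
proof -
  have pq: "p \<in> X" "q \<in> X" "p \<noteq> q" using pencil_carrier[OF f] by auto
  have hx: "h x \<in> X - {p, q}" and fx: "f x \<in> X - {p, q}"
    using pencil_in f h x by auto
  have G: "h \<in> \<Gamma>" using h pencilD by auto
  have "through p q (h x) \<in> L p q" "through p q (f x) \<in> L p q"
    using hx fx pq by (intro through; auto)+
  then have "h \<circ> ratio p q (h x) (f x) \<in> L p q"
    unfolding ratio_def using h by (intro pencil_closed)
  moreover have "(h \<circ> ratio p q (h x) (f x)) x = f x"
    using ratio_inv_apply[OF h hx fx] G by simp
  ultimately have "f = h \<circ> ratio p q (h x) (f x)"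
    using pencil_eqI[OF f _ x] by metis
  then show ?thesis using comp_inv(1)[OF G] by metis
qed

lemma ratio_commute_same:
  assumes "{p, q, r, s, t, u} \<subseteq> X" "p \<noteq> q" "{r, s, t, u} \<inter> {p, q} = {}"
  shows "ratio p q r s \<circ> ratio p q t u = ratio p q t u \<circ> ratio p q r s"
  unfolding ratio_def using assms by (intro quotient_commute[of _ p q] through) auto

lemma ratio_inverse:
  assumes "{p, q, r, s} \<subseteq> X" "p \<noteq> q" "{r, s} \<inter> {p, q} = {}"
  shows "ratio p q r s \<circ> ratio p q s r = id"
  using ratio_trans[of p q r s r] ratio_refl[of p q r] assms by auto

lemma ratio_inverse':
  assumes "{p, q, r, s} \<subseteq> X" "distinct [p, q, r, s]"
  shows "ratio p q r s \<circ> ratio q p r s = id"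
  using ratio_inverse[of r s p q] ratio_symmetric[of p q r s] ratio_symmetric[of q p r s] assms
  by auto

lemma commute_inverse:
  fixes f g g' :: "'a \<Rightarrow> 'a"
  assumes "f \<circ> g = g \<circ> f" "g \<circ> g' = id" "g' \<circ> g = id"
  shows "f \<circ> g' = g' \<circ> f"
  using assms by (metis comp_assoc comp_id id_comp)

text \<open>
  Expanding \<open>ratio p u r t\<close> first over \<open>s\<close> and then over \<open>q\<close>, or in the opposite order, gives two
  products of four factors which differ in the order of the two middle ones.
\<close>

lemma ratio_commute_cross:
  assumes X: "{p, q, u, r, s, t} \<subseteq> X" and d: "distinct [p, q, u]" "distinct [r, s, t]"
    "{p, q, u} \<inter> {r, s, t} = {}"
  shows "ratio q u r s \<circ> ratio p q s t = ratio p q s t \<circ> ratio q u r s"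
proof -
  let ?a = "ratio p q r s" and ?w = "ratio q u s t"
    and ?x = "ratio q u r s" and ?y = "ratio p q s t"
  have "ratio p u r s = ?a \<circ> ?x" "ratio p u s t = ?y \<circ> ?w" "ratio p u r t = ratio p q r t \<circ> ratio q u r t"
    using X d by (intro ratio_trans'[symmetric]; auto)+
  moreover have "ratio p q r t = ?a \<circ> ?y" "ratio q u r t = ?x \<circ> ?w"
    "ratio p u r t = ratio p u r s \<circ> ratio p u s t"
    using X d by (intro ratio_trans[symmetric]; auto)+
  ultimately have eq: "?a \<circ> (?x \<circ> ?y) \<circ> ?w = ?a \<circ> (?y \<circ> ?x) \<circ> ?w"
    by (simp add: comp_assoc)
  have "bij ?a" "bij ?w" using X d by (intro ratio_bij; auto)+
  show ?thesis
  proof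
    fix z
    obtain v where "z = ?w v" using bij_is_surj[OF \<open>bij ?w\<close>] by blast
    then show "(?x \<circ> ?y) z = (?y \<circ> ?x) z"
      using fun_cong[OF eq, of v] injD[OF bij_is_inj[OF \<open>bij ?a\<close>]] by auto
  qed
qed

lemma ratio_commute_base:
  assumes X: "{p, q, u, r, s, t} \<subseteq> X" and d: "distinct [p, q, u]"
    "{p, q, u} \<inter> {r, s, t} = {}"
  shows "ratio p q r s \<circ> ratio p u r t = ratio p u r t \<circ> ratio p q r s"
proof -
  consider "r = s" | "r = t" | "r \<noteq> s" "s = t" | "distinct [r, s, t]" by auto
  then show ?thesis
  proof cases
    case 1
    then show ?thesis using ratio_refl[of p q r] X d by auto
  next
    case 2
    then show ?thesis using ratio_refl[of p u r] X d by auto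
  next
    \<comment> \<open>Here symmetry turns both factors into ratios over the same pencil
      \<open>L r s\<close>, where quotients commute.\<close>
    case 3
    then have "ratio p q r s = ratio r s p q" "ratio p u r t = ratio r s p u"
      using X d ratio_symmetric[of p q r s] ratio_symmetric[of p u r t] by auto
    then show ?thesis using ratio_commute_same[of r s p q p u] X d 3 by auto
  next
    case 4
    \<comment> \<open>The cross lemma gives commutation for the inverses of both factors; these are
      then inverted one at a time.\<close>
    have "ratio q p r s \<circ> ratio p u t r = ratio p u t r \<circ> ratio q p r s"
      using ratio_commute_cross[of q p u t r s] X d 4 by auto
    moreover have "ratio p u t r \<circ> ratio p u r t = id" "ratio p u r t \<circ> ratio p u t r = id"
      using X d by (intro ratio_inverse; auto)+
    ultimately have "ratio q p r s \<circ> ratio p u r t = ratio p u r t \<circ> ratio q p r s"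
      by (rule commute_inverse)
    moreover have "ratio q p r s \<circ> ratio p q r s = id" "ratio p q r s \<circ> ratio q p r s = id"
      using X d 4 by (intro ratio_inverse'; auto)+
    ultimately show ?thesis using commute_inverse[of "ratio p u r t"] by metis
  qed
qed

text \<open>Splitting \<open>ratio p u t v\<close> at \<open>r\<close> leaves factors that start or
  end at \<open>r\<close>, which \<open>ratio_commute_base\<close> handles up to an inverse.\<close>

lemma ratio_commute:
  assumes X: "{p, q, u, r, s, t, v} \<subseteq> X" and d: "distinct [p, q, u]"
    "{p, q, u} \<inter> {r, s, t, v} = {}"
  shows "ratio p q r s \<circ> ratio p u t v = ratio p u t v \<circ> ratio p q r s"
proof -
  let ?f = "ratio p q r s"
  have v: "?f \<circ> ratio p u r v = ratio p u r v \<circ> ?f" and "?f \<circ> ratio p u r t = ratio p u r t \<circ> ?f"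
    using X d by (intro ratio_commute_base; auto)+
  moreover have "ratio p u t r \<circ> ratio p u r t = id" "ratio p u r t \<circ> ratio p u t r = id"
    using X d by (intro ratio_inverse; auto)+
  ultimately have t: "?f \<circ> ratio p u t r = ratio p u t r \<circ> ?f"
    using commute_inverse by metis
  have "ratio p u t v = ratio p u t r \<circ> ratio p u r v"
    using X d by (intro ratio_trans[symmetric]) auto
  then show ?thesis using t v by (metis comp_assoc)
qed

text \<open>To apply \<open>ratio_commute\<close>, the entries of each ratio must avoid the
  remaining one of \<open>q\<close> and \<open>u\<close>. This excludes up to four elements when
  choosing \<open>x\<close> or \<open>y\<close>, whence the size bound.\<close>

lemma quotient_commute_distinct:
  assumes big: "\<not> (finite X \<and> card X \<le> 4)"
    and fh: "f \<in> L p q" "h \<in> L p q" and gk: "g \<in> L p u" "k \<in> L p u" and "q \<noteq> u"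
  shows "(inv h \<circ> f) \<circ> (inv k \<circ> g) = (inv k \<circ> g) \<circ> (inv h \<circ> f)"
proof -
  have pqu: "{p, q, u} \<subseteq> X" "distinct [p, q, u]"
    using pencil_carrier[OF fh(1)] pencil_carrier[OF gk(1)] \<open>q \<noteq> u\<close> by auto
  obtain x where "x \<in> X" "x \<notin> set [a, b, inv f u, inv h u]"
    using avoid[OF big, of "[a, b, inv f u, inv h u]"] by auto
  then have x: "x \<in> X - {a, b}" "f x \<noteq> u" "h x \<noteq> u" using fh pencilD(1) by auto
  obtain y where "y \<in> X" "y \<notin> set [a, b, inv g q, inv k q]"
    using avoid[OF big, of "[a, b, inv g q, inv k q]"] by auto
  then have y: "y \<in> X - {a, b}" "g y \<noteq> q" "k y \<noteq> q" using gk pencilD(1) by auto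
  show ?thesis
    unfolding quotient_eq_ratio[OF fh x(1)] quotient_eq_ratio[OF gk y(1)]
    using pqu pencil_in[OF fh(1) x(1)] pencil_in[OF fh(2) x(1)]
      pencil_in[OF gk(1) y(1)] pencil_in[OF gk(2) y(1)] x y
    by (intro ratio_commute) auto
qed

text \<open>The argument of \<open>pencil_closed\<close> is repeated, with commutation of quotients
  from the two different pencils. It shows that \<open>A(p,q)\<close> acts on
  \<open>L p u\<close>.\<close>

lemma pencil_transfer:
  assumes big: "\<not> (finite X \<and> card X \<le> 4)"
    and f: "f \<in> L p q" and h: "h \<in> L p q" and g: "g \<in> L p u"
  shows "g \<circ> (inv h \<circ> f) \<in> L p u"
proof (cases "q = u")
  case True
  then show ?thesis using assms by (intro pencil_closed) auto
next
  case False
  have G: "f \<in> \<Gamma>" "g \<in> \<Gamma>" "h \<in> \<Gamma>" using assms pencilD by auto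
  have c: "c \<in> X - {a, b}" using frame by auto
  obtain m where m: "m \<in> L p u" "m c = g (inv h (f c))"
    using pencil_transitive[OF c pencil_in[OF g pencil_inv_in[OF h pencil_in[OF f c]]]]
      pencil_carrier[OF g] by auto
  have "m x = g (inv h (f x))" for x
  proof (cases "x \<in> X - {a, b}")
    case False
    then have "f x = h x" "m x = g x" using f g h m(1) pencil_agree by metis+
    then show ?thesis using G by simp
  next
    case x: True
    obtain e where e: "e \<in> L p u" "e c = g x"
      using pencil_transitive[OF c pencil_in[OF g x]] pencil_carrier[OF g] by auto
    have x_eq: "x = inv g (e c)" using e G by simp
    have 1: "inv h (f (inv g (e c))) = inv g (e (inv h (f c)))"
      using quotient_commute_distinct[OF big f h e(1) g False] by (simp add: fun_eq_iff)
    have "m x = e (inv g (m c))" unfolding x_eq using pencil_commute[OF m(1) e(1) g] .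
    also have "\<dots> = e (inv h (f c))" using m(2) G by simp
    also have "\<dots> = g (inv h (f x))" using 1 G x_eq by simp
    finally show ?thesis .
  qed
  then have "m = g \<circ> (inv h \<circ> f)" by auto
  then show ?thesis using m by simp
qed

end

section \<open>Passage between arbitrary pencils and closure under the ternary product\<close>

context symmetric_permutation_set
begin

lemma transfer_one:
  assumes big: "\<not> (finite X \<and> card X \<le> 4)" and ab: "a \<in> X" "b \<in> X" "a \<noteq> b"
    and "f \<in> pencil a b p q" "h \<in> pencil a b p q" "g \<in> pencil a b r s" "p = r \<or> q = s"
  shows "g \<circ> (inv h \<circ> f) \<in> pencil a b r s"
proof -
  have "\<not> X \<subseteq> {a, b}"
    using big card_mono[of "{a, b}" X] finite_subset[of X "{a, b}"] ab by auto
  then obtain c where c: "c \<in> X" "c \<noteq> a" "c \<noteq> b" by blast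
  interpret frame X \<Gamma> a b c using ab c by unfold_locales auto
  \<comment> \<open>Exchanging \<open>a\<close> and \<open>b\<close> turns a common second value
    into a common first value.\<close>
  interpret flipped: frame X \<Gamma> b a c using ab c by unfold_locales auto
  from assms(8) show ?thesis
  proof
    assume "p = r"
    then show ?thesis using pencil_transfer[OF big] assms by auto
  next
    assume "q = s"
    then show ?thesis using flipped.pencil_transfer[OF big] assms pencil_flip by metis
  qed
qed

lemma pencil_nonempty:
  assumes "\<not> (finite X \<and> card X \<le> 4)" "{a, b, p, q} \<subseteq> X" "a \<noteq> b" "p \<noteq> q"
  obtains f where "f \<in> pencil a b p q"
proof -
  have "\<not> X \<subseteq> {a, b}" "\<not> X \<subseteq> {p, q}"
    using assms card_mono[of "{a, b}" X] finite_subset[of X "{a, b}"]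
      card_mono[of "{p, q}" X] finite_subset[of X "{p, q}"] by auto
  then obtain c r where "c \<in> X" "c \<noteq> a" "c \<noteq> b" "r \<in> X" "r \<noteq> p" "r \<noteq> q" by blast
  then have "\<exists>!f. f \<in> \<Gamma> \<and> f a = p \<and> f b = q \<and> f c = r"
    using assms by (intro sharp) auto
  then show ?thesis using that by (auto simp: pencil_def)
qed

text \<open>The pencil \<open>a \<mapsto> p, b \<mapsto> s\<close> shares one value with each of the
  two pencils; \<open>p \<noteq> s\<close> ensures that it has a member \<open>e\<close>.\<close>

lemma transfer_two:
  assumes big: "\<not> (finite X \<and> card X \<le> 4)" and ab: "a \<in> X" "b \<in> X" "a \<noteq> b"
    and f: "f \<in> pencil a b p q" and h: "h \<in> pencil a b p q" and g: "g \<in> pencil a b r s" and "p \<noteq> s"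
  shows "g \<circ> (inv h \<circ> f) \<in> pencil a b r s"
proof -
  have "p \<in> X" "s \<in> X" using ab f g by (auto simp: pencil_def)
  then obtain e where e: "e \<in> pencil a b p s"
    using pencil_nonempty[OF big, of a b p s] ab \<open>p \<noteq> s\<close> by auto
  have "e \<circ> (inv h \<circ> f) \<in> pencil a b p s" using transfer_one[OF big ab f h e] by simp
  then have "g \<circ> (inv e \<circ> (e \<circ> (inv h \<circ> f))) \<in> pencil a b r s"
    using transfer_one[OF big ab _ e g] by simp
  then show ?thesis using pencilD(1)[OF e] by simp
qed

lemma transfer:
  assumes big: "\<not> (finite X \<and> card X \<le> 4)" and ab: "a \<in> X" "b \<in> X" "a \<noteq> b"
    and fh: "f \<in> \<Gamma>" "h \<in> \<Gamma>" "f a = h a" "f b = h b" and g: "g \<in> \<Gamma>"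
  shows "g \<circ> (inv h \<circ> f) \<in> \<Gamma>"
proof -
  define p q where "p = h a" and "q = h b"
  have f: "f \<in> pencil a b p q" and h: "h \<in> pencil a b p q" and g': "g \<in> pencil a b (g a) (g b)"
    using fh g by (auto simp: pencil_def p_def q_def)
  have pq: "p \<in> X" "q \<in> X" "p \<noteq> q" using ab fh by (auto simp: p_def q_def)
  \<comment> \<open>A detour through \<open>a \<mapsto> t, b \<mapsto> q\<close> covers the case
    \<open>p = g b\<close>: \<open>t \<noteq> q\<close> gives the detour a member, and
    \<open>t \<noteq> g b\<close> lets \<open>transfer_two\<close> leave it.\<close>
  obtain t where t: "t \<in> X" "t \<notin> set [p, q, g a, g b]"
    using avoid[OF big, of "[p, q, g a, g b]"] by auto
  obtain e where e: "e \<in> pencil a b t q"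
    using pencil_nonempty[OF big, of a b t q] ab pq t by auto
  have "e \<circ> (inv h \<circ> f) \<in> pencil a b t q"
    using transfer_one[OF big ab f h e] by simp
  then have "g \<circ> (inv e \<circ> (e \<circ> (inv h \<circ> f))) \<in> pencil a b (g a) (g b)"
    using transfer_two[OF big ab _ e g'] t by auto
  then show ?thesis using pencilD(1)[OF e] pencilD(1) by simp
qed

text \<open>The quotient telescopes along a chain \<open>h, k, l, g\<close> whose consecutive
  members agree at \<open>a, b\<close>, then \<open>a, x\<close>, then \<open>x, y\<close>; each
  link is one use of \<open>transfer\<close>.\<close>

theorem closed:
  assumes G: "f \<in> \<Gamma>" "g \<in> \<Gamma>" "h \<in> \<Gamma>" and X4: "\<not> (finite X \<and> card X \<le> 3)"
  shows "f \<circ> (inv h \<circ> g) \<in> \<Gamma>"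
proof (cases "finite X \<and> card X \<le> 4")
  case False
  note big = this
  obtain a where a: "a \<in> X" using avoid[OF big, of "[]"] by auto
  \<comment> \<open>The excluded preimages \<open>inv g (h a)\<close> and, below,
    \<open>inv h (g x)\<close> keep the values prescribed for \<open>k\<close> and \<open>l\<close>
    distinct.\<close>
  obtain x where x: "x \<in> X" "x \<notin> set [a, inv g (h a)]"
    using avoid[OF big, of "[a, inv g (h a)]"] by auto
  obtain y where y: "y \<in> X" "y \<notin> set [a, inv g (h a), x]"
    using avoid[OF big, of "[a, inv g (h a), x]"] by auto
  obtain b where b: "b \<in> X" "b \<notin> set [a, x, inv h (g x)]"
    using avoid[OF big, of "[a, x, inv h (g x)]"] by auto
  have x': "g x \<noteq> h a" and y': "g y \<noteq> h a" and b': "h b \<noteq> g x"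
    using x(2) y(2) b(2) inv_eq[OF G(2), of "h a" x] inv_eq[OF G(2), of "h a" y]
      inv_eq[OF G(3), of "g x" b] by auto
  have "\<exists>!k. k \<in> \<Gamma> \<and> k a = h a \<and> k b = h b \<and> k x = g x"
    using a x b x' b' G by (intro sharp) auto
  then obtain k where k: "k \<in> \<Gamma>" "k a = h a" "k b = h b" "k x = g x" by blast
  have "\<exists>!l. l \<in> \<Gamma> \<and> l a = h a \<and> l x = g x \<and> l y = g y"
    using a x y x' y' G by (intro sharp) auto
  then obtain l where l: "l \<in> \<Gamma>" "l a = h a" "l x = g x" "l y = g y" by blast
  have 1: "f \<circ> (inv h \<circ> k) \<in> \<Gamma>"
    using transfer[OF big, of a b k h f] a b k G by auto
  have 2: "(f \<circ> (inv h \<circ> k)) \<circ> (inv k \<circ> l) \<in> \<Gamma>"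
    using transfer[OF big, of a x l k] a x k l 1 by auto
  have "((f \<circ> (inv h \<circ> k)) \<circ> (inv k \<circ> l)) \<circ> (inv l \<circ> g) \<in> \<Gamma>"
    using transfer[OF big, of x y g l] x y l 2 G by auto
  then show ?thesis using k l by (simp add: comp_assoc)
next
  \<comment> \<open>On four elements three values of a permutation force the fourth, so sharp
    3-transitivity already puts every permutation of \<open>X\<close> into
    \<open>\<Gamma>\<close>.\<close>
  case True
  then have "card X = 4" using X4 by auto
  then obtain a b c d where X: "X = {a, b, c, d}" and d: "distinct [a, b, c, d]"
    by (auto simp: card_Suc_eq eval_nat_numeral)
  let ?m = "f \<circ> (inv h \<circ> g)"
  have inj: "?m x = ?m y \<longleftrightarrow> x = y" and in_X: "?m x \<in> X \<longleftrightarrow> x \<in> X" for x y using G by auto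
  have "\<exists>!k. k \<in> \<Gamma> \<and> k a = ?m a \<and> k b = ?m b \<and> k c = ?m c"
    using in_X[of a] in_X[of b] in_X[of c] d X inj[of a b] inj[of a c] inj[of b c]
    by (intro sharp) auto
  then obtain k where k: "k \<in> \<Gamma>" "k a = ?m a" "k b = ?m b" "k c = ?m c" by blast
  have abcd: "a \<in> X" "b \<in> X" "c \<in> X" "d \<in> X" using X by auto
  have "k d \<in> X - {k a, k b, k c}" using k(1) d abcd by auto
  moreover have "?m d \<in> X - {?m a, ?m b, ?m c}"
    using in_X[of d] inj[of d a] inj[of d b] inj[of d c] d abcd by auto
  moreover have "card (X - {k a, k b, k c}) = 1"
  proof -
    have "card {k a, k b, k c} = 3" "{k a, k b, k c} \<subseteq> X" using k(1) d abcd by auto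
    then show ?thesis using \<open>card X = 4\<close> by (simp add: card_Diff_subset)
  qed
  ultimately have "k d = ?m d" using k(2-) by (metis card_1_singletonE singletonD)
  moreover have "k x = ?m x" if "x \<notin> X" for x
    using that outside(1)[OF G(1)] outside(1)[OF G(2)] outside(2)[OF G(3)] outside(1)[OF k(1)] by simp
  ultimately have "k x = ?m x" for x using k(2-) X by (cases "x \<in> X") auto
  then have "k = ?m" by auto
  then show ?thesis using k(1) by simp
qed

end

section \<open>Coordinates on the plane and circles as permutations\<close>

locale based_plane = symmetric_minkowski_plane +
  fixes E :: "'a set"
  assumes E: "E \<in> \<Lambda>"
begin

definition trace :: "'a set \<Rightarrow> 'a set \<Rightarrow> 'a" where
  "trace K G = (THE x. x \<in> G \<inter> K)"

text \<open>
  The base circle \<open>E\<close> identifies the two classes of generators, so that points become pairs and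
  circles become permutations of \<open>\<Sigma>\<^sub>1\<close>.
\<close>

definition ordinate :: "'a \<Rightarrow> 'a set" where
  "ordinate p = gen \<Sigma>\<^sub>1 (trace E (gen \<Sigma>\<^sub>2 p))"

text \<open>The value \<open>G\<close> off \<open>\<Sigma>\<^sub>1\<close> makes
  \<open>perm K\<close> the identity there, as \<open>permutes\<close> demands.\<close>

definition perm :: "'a set \<Rightarrow> 'a set \<Rightarrow> 'a set" where
  "perm K G = (if G \<in> \<Sigma>\<^sub>1 then ordinate (trace K G) else G)"

lemma circle_point: "K \<in> \<Lambda> \<Longrightarrow> p \<in> K \<Longrightarrow> p \<in> P"
  using subsets by blast

lemma trace:
  assumes "G \<in> \<Sigma>\<^sub>1 \<union> \<Sigma>\<^sub>2" "K \<in> \<Lambda>"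
  shows "trace K G \<in> G" "trace K G \<in> K" "trace K G \<in> P"
  using theI'[OF H3[OF assms]] assms(2) circle_point unfolding trace_def by auto

lemma gen_trace1: "G \<in> \<Sigma>\<^sub>1 \<Longrightarrow> K \<in> \<Lambda> \<Longrightarrow> gen \<Sigma>\<^sub>1 (trace K G) = G"
  using trace by (intro gen1_eq) auto

lemma gen_trace2: "G \<in> \<Sigma>\<^sub>2 \<Longrightarrow> K \<in> \<Lambda> \<Longrightarrow> gen \<Sigma>\<^sub>2 (trace K G) = G"
  using trace by (intro gen2_eq) auto

lemma trace_gen1: "K \<in> \<Lambda> \<Longrightarrow> p \<in> K \<Longrightarrow> trace K (gen \<Sigma>\<^sub>1 p) = p"
  using trace[of "gen \<Sigma>\<^sub>1 p" K] gen1[OF circle_point] gen_trace1 by (intro circle_eqI[of K]) auto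

lemma trace_gen2: "K \<in> \<Lambda> \<Longrightarrow> p \<in> K \<Longrightarrow> trace K (gen \<Sigma>\<^sub>2 p) = p"
  using trace[of "gen \<Sigma>\<^sub>2 p" K] gen2[OF circle_point] gen_trace2 by (intro circle_eqI[of K]) auto

lemma ordinate_in: "p \<in> P \<Longrightarrow> ordinate p \<in> \<Sigma>\<^sub>1"
  unfolding ordinate_def using gen2(1) trace(3)[OF _ E] by (intro gen1(1)) blast

lemma ordinate_eq_iff:
  assumes "p \<in> P" "q \<in> P"
  shows "ordinate p = ordinate q \<longleftrightarrow> gen \<Sigma>\<^sub>2 p = gen \<Sigma>\<^sub>2 q"
proof
  assume "ordinate p = ordinate q"
  then have "trace E (gen \<Sigma>\<^sub>2 p) = trace E (gen \<Sigma>\<^sub>2 q)"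
    using trace(2)[OF _ E] gen2(1) assms by (intro circle_eqI[OF E]) (auto simp: ordinate_def)
  then show "gen \<Sigma>\<^sub>2 p = gen \<Sigma>\<^sub>2 q"
    using gen_trace2[OF _ E] gen2(1) assms by metis
qed (simp add: ordinate_def)

lemma ordinate_meet: "p \<in> P \<Longrightarrow> q \<in> P \<Longrightarrow> ordinate (p \<diamondop> q) = ordinate q"
  using ordinate_eq_iff meet_gen by auto

lemma coordinates_eqI:
  "\<lbrakk>p \<in> P; q \<in> P; gen \<Sigma>\<^sub>1 p = gen \<Sigma>\<^sub>1 q; ordinate p = ordinate q\<rbrakk> \<Longrightarrow> p = q"
  using ordinate_eq_iff point_eqI by blast

lemma coordinates:
  assumes "G \<in> \<Sigma>\<^sub>1" "H \<in> \<Sigma>\<^sub>1"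
  obtains p where "p \<in> P" "gen \<Sigma>\<^sub>1 p = G" "ordinate p = H"
proof
  let ?p = "trace E G \<diamondop> trace E H"
  have P: "trace E G \<in> P" "trace E H \<in> P" and e: "trace E H \<in> E" using assms trace E by auto
  show "?p \<in> P" "gen \<Sigma>\<^sub>1 ?p = G" using meet_gen[OF P] gen_trace1 assms E by auto
  show "ordinate ?p = H"
    using ordinate_meet[OF P] trace_gen2[OF E e] gen_trace1[OF assms(2) E] by (simp add: ordinate_def)
qed

text \<open>The generator \<open>gen \<Sigma>\<^sub>1 p\<close> meets \<open>K\<close> only once,
  and coordinates determine a point; so \<open>K\<close> is the graph of
  \<open>perm K\<close>.\<close>

lemma in_circle_iff:
  assumes "K \<in> \<Lambda>" "p \<in> P"
  shows "p \<in> K \<longleftrightarrow> perm K (gen \<Sigma>\<^sub>1 p) = ordinate p"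
proof
  assume "p \<in> K"
  then show "perm K (gen \<Sigma>\<^sub>1 p) = ordinate p"
    using trace_gen1 gen1(1) assms by (simp add: perm_def)
next
  assume *: "perm K (gen \<Sigma>\<^sub>1 p) = ordinate p"
  have G: "gen \<Sigma>\<^sub>1 p \<in> \<Sigma>\<^sub>1" using gen1(1) assms by simp
  have "trace K (gen \<Sigma>\<^sub>1 p) = p"
    using * G gen_trace1[OF G assms(1)] trace[of "gen \<Sigma>\<^sub>1 p" K] assms
    by (intro coordinates_eqI) (auto simp: perm_def)
  then show "p \<in> K" using trace(2)[of "gen \<Sigma>\<^sub>1 p" K] G assms(1) by simp
qed

lemma perm_permutes:
  assumes K: "K \<in> \<Lambda>"
  shows "perm K permutes \<Sigma>\<^sub>1"
proof (rule bij_imp_permutes)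
  have "inj_on (perm K) \<Sigma>\<^sub>1"
  proof (rule inj_onI)
    fix G H assume GH: "G \<in> \<Sigma>\<^sub>1" "H \<in> \<Sigma>\<^sub>1" and eq: "perm K G = perm K H"
    have "gen \<Sigma>\<^sub>2 (trace K G) = gen \<Sigma>\<^sub>2 (trace K H)"
      using ordinate_eq_iff[of "trace K G" "trace K H"] trace(3)[OF _ K] GH eq
      by (simp add: perm_def)
    then have "trace K G = trace K H"
      using GH trace(2)[OF _ K] by (intro circle_eqI[OF K]) auto
    then show "G = H" using gen_trace1[OF _ K] GH by metis
  qed
  moreover have "perm K ` \<Sigma>\<^sub>1 = \<Sigma>\<^sub>1"
  proof (intro equalityI subsetI)
    fix H assume H: "H \<in> \<Sigma>\<^sub>1"
    obtain e where e: "e \<in> P" "ordinate e = H" using coordinates[OF H H] by metis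
    \<comment> \<open>The preimage of \<open>H\<close> is found by following the second-class
      generator at height \<open>H\<close> to its point on \<open>K\<close>.\<close>
    let ?x = "trace K (gen \<Sigma>\<^sub>2 e)"
    have G: "gen \<Sigma>\<^sub>2 e \<in> \<Sigma>\<^sub>2" using gen2(1) e by simp
    have x: "?x \<in> K" "?x \<in> P" using trace G K by auto
    have "ordinate ?x = H" using ordinate_eq_iff[OF x(2) e(1)] gen_trace2[OF G K] e by simp
    then have "perm K (gen \<Sigma>\<^sub>1 ?x) = H" using in_circle_iff[OF K x(2)] x by simp
    then show "H \<in> perm K ` \<Sigma>\<^sub>1" using gen1(1)[OF x(2)] by blast
  qed (use trace(3)[OF _ K] ordinate_in in \<open>auto simp: perm_def\<close>)
  ultimately show "bij_betw (perm K) \<Sigma>\<^sub>1 \<Sigma>\<^sub>1" by (simp add: bij_betw_def)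
qed (simp add: perm_def)

lemma perm_sharp:
  assumes "{a, b, c} \<subseteq> \<Sigma>\<^sub>1" "distinct [a, b, c]" "{p, q, r} \<subseteq> \<Sigma>\<^sub>1" "distinct [p, q, r]"
  shows "\<exists>!f. f \<in> perm ` \<Lambda> \<and> f a = p \<and> f b = q \<and> f c = r"
proof -
  obtain A where A: "A \<in> P" "gen \<Sigma>\<^sub>1 A = a" "ordinate A = p" using coordinates[of a p] assms by auto
  obtain B where B: "B \<in> P" "gen \<Sigma>\<^sub>1 B = b" "ordinate B = q" using coordinates[of b q] assms by auto
  obtain C where C: "C \<in> P" "gen \<Sigma>\<^sub>1 C = c" "ordinate C = r" using coordinates[of c r] assms by auto
  have g1: "distinct [gen \<Sigma>\<^sub>1 A, gen \<Sigma>\<^sub>1 B, gen \<Sigma>\<^sub>1 C]" using A B C assms by simp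
  have g2: "distinct [gen \<Sigma>\<^sub>2 A, gen \<Sigma>\<^sub>2 B, gen \<Sigma>\<^sub>2 C]"
    using A B C assms ordinate_eq_iff[of A B] ordinate_eq_iff[of A C] ordinate_eq_iff[of B C] by simp
  have "distinct [A, B, C]" using g1 by auto
  then have "\<exists>!K. K \<in> \<Lambda> \<and> {A, B, C} \<subseteq> K"
    using g1 g2 by (intro H4 A(1) B(1) C(1)) auto
  moreover have "{A, B, C} \<subseteq> K \<longleftrightarrow> perm K a = p \<and> perm K b = q \<and> perm K c = r" if "K \<in> \<Lambda>" for K
    using in_circle_iff[OF that] A B C by auto
  ultimately show ?thesis by (smt (verit, best) imageE imageI)
qed

text \<open>The points \<open>(a, f a)\<close> and \<open>(b, f b)\<close> of \<open>L\<close> are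
  mirror images in \<open>K\<close>, so the symmetry axiom gives
  \<open>K \<bottom>\<bottom> L\<close>. The mirror image \<open>(y, k x)\<close> of the point
  \<open>(x, f x)\<close> of \<open>L\<close> then lies on \<open>L\<close> too.\<close>

lemma perm_swap:
  assumes f: "f \<in> perm ` \<Lambda>" and k: "k \<in> perm ` \<Lambda>" and ab: "a \<in> \<Sigma>\<^sub>1" "b \<in> \<Sigma>\<^sub>1" "a \<noteq> b"
    and fk: "f a = k b" "f b = k a" and xy: "x \<in> \<Sigma>\<^sub>1" "y \<in> \<Sigma>\<^sub>1" "f x = k y"
  shows "f y = k x"
proof -
  obtain K L where K: "K \<in> \<Lambda>" "k = perm K" and L: "L \<in> \<Lambda>" "f = perm L" using f k by auto
  have bij: "k permutes \<Sigma>\<^sub>1" "f permutes \<Sigma>\<^sub>1" using perm_permutes K L by auto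
  have in\<Sigma>: "f z \<in> \<Sigma>\<^sub>1 \<longleftrightarrow> z \<in> \<Sigma>\<^sub>1" "k z \<in> \<Sigma>\<^sub>1 \<longleftrightarrow> z \<in> \<Sigma>\<^sub>1" for z
    using bij permutes_in_image by metis+
  have reflect: "circle_symmetry K p = q"
    if "p \<in> P" "q \<in> P" "k (gen \<Sigma>\<^sub>1 p) = ordinate q" "k (gen \<Sigma>\<^sub>1 q) = ordinate p" for p q
    using that K in_circle_iff[OF K(1)] meet_gen ordinate_meet
    by (intro circle_symmetry_eqI) auto
  obtain p where p: "p \<in> P" "gen \<Sigma>\<^sub>1 p = a" "ordinate p = f a" using coordinates[of a "f a"] ab in\<Sigma> by auto
  obtain q where q: "q \<in> P" "gen \<Sigma>\<^sub>1 q = b" "ordinate q = f b" using coordinates[of b "f b"] ab in\<Sigma> by auto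
  have "p \<in> L" "q \<in> L" using in_circle_iff[OF L(1)] p q L(2) by auto
  moreover have "p \<notin> K"
    using in_circle_iff[OF K(1) p(1)] p K fk(1) ab(3) permutes_inj[OF bij(1)] by (auto dest: injD)
  moreover have "circle_symmetry K p = q" using reflect p q fk by auto
  ultimately have orth: "K \<bottom>\<bottom> L" using symmetry_axiom[OF K(1) L(1), of p] by auto
  obtain u where u: "u \<in> P" "gen \<Sigma>\<^sub>1 u = x" "ordinate u = f x" using coordinates[of x "f x"] xy in\<Sigma> by auto
  obtain v where v: "v \<in> P" "gen \<Sigma>\<^sub>1 v = y" "ordinate v = k x" using coordinates[of y "k x"] xy in\<Sigma> by auto
  have "u \<in> L" using in_circle_iff[OF L(1)] u L(2) by auto
  moreover have "circle_symmetry K u = v" using reflect u v xy by auto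
  ultimately have "v \<in> L" using orth by (auto simp: orthogonal_def)
  then show ?thesis using in_circle_iff[OF L(1) v(1)] v L(2) by simp
qed

sublocale circles: symmetric_permutation_set \<Sigma>\<^sub>1 "perm ` \<Lambda>"
proof
  show "f permutes \<Sigma>\<^sub>1" if "f \<in> perm ` \<Lambda>" for f using that perm_permutes by auto
qed (fact perm_sharp, fact perm_swap)

text \<open>In coordinates, \<open>?h\<close> sends the abscissa of \<open>p i\<close> to the
  ordinate of \<open>q i\<close>. Hence \<open>?f \<circ> (inv ?h \<circ> ?g)\<close> sends the
  abscissa of \<open>q i\<close> to the ordinate of \<open>p i\<close>, and closure makes it a
  circle.\<close>

theorem rectangle: rectangle_axiom
  unfolding rectangle_axiom_def
proof (intro allI impI, elim conjE)
  fix p q :: "nat \<Rightarrow> 'a"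
  let ?I = "{1..4::nat}"
  assume P: "p ` ?I \<subseteq> P" "q ` ?I \<subseteq> P" and inj: "inj_on p ?I"
    and "concyclic (p ` ?I)" "concyclic (q ` ?I)" "concyclic ((\<lambda>i. p i \<diamondop> q i) ` ?I)"
  then obtain F G H where circles: "F \<in> \<Lambda>" "G \<in> \<Lambda>" "H \<in> \<Lambda>"
    and sub: "p ` ?I \<subseteq> F" "q ` ?I \<subseteq> G" "(\<lambda>i. p i \<diamondop> q i) ` ?I \<subseteq> H"
    by (auto simp: concyclic_def)
  let ?f = "perm F" and ?g = "perm G" and ?h = "perm H"
  \<comment> \<open>Four distinct points of one circle lie on four distinct generators, which gives
    the size bound for \<open>closed\<close>.\<close>
  have "inj_on (\<lambda>i. gen \<Sigma>\<^sub>1 (p i)) ?I"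
    using inj circle_eqI[OF circles(1)] sub(1) unfolding inj_on_def by (metis image_subset_iff)
  moreover have "(\<lambda>i. gen \<Sigma>\<^sub>1 (p i)) ` ?I \<subseteq> \<Sigma>\<^sub>1" using P gen1(1) by auto
  ultimately have "card ?I \<le> card \<Sigma>\<^sub>1" if "finite \<Sigma>\<^sub>1" using that card_inj_on_le by metis
  then have "\<not> (finite \<Sigma>\<^sub>1 \<and> card \<Sigma>\<^sub>1 \<le> 3)" by auto
  then have "?f \<circ> (inv ?h \<circ> ?g) \<in> perm ` \<Lambda>" using circles.closed circles by auto
  then obtain M where M: "M \<in> \<Lambda>" "perm M = ?f \<circ> (inv ?h \<circ> ?g)" by auto
  have "q i \<diamondop> p i \<in> M" if i: "i \<in> ?I" for i
  proof -
    have pq: "p i \<in> P" "q i \<in> P" "p i \<in> F" "q i \<in> G" "p i \<diamondop> q i \<in> H" using i P sub by auto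
    have f: "?f (gen \<Sigma>\<^sub>1 (p i)) = ordinate (p i)" and g: "?g (gen \<Sigma>\<^sub>1 (q i)) = ordinate (q i)"
      using in_circle_iff circles pq by auto
    have h: "?h (gen \<Sigma>\<^sub>1 (p i)) = ordinate (q i)"
      using in_circle_iff[of H "p i \<diamondop> q i"] meet_gen ordinate_meet circles pq by auto
    have "inv ?h (ordinate (q i)) = gen \<Sigma>\<^sub>1 (p i)"
      unfolding h[symmetric] using circles(3) by simp
    then have "perm M (gen \<Sigma>\<^sub>1 (q i)) = ordinate (p i)" using M(2) f g by simp
    then show ?thesis
      using in_circle_iff[OF M(1), of "q i \<diamondop> p i"] meet_gen ordinate_meet pq by auto
  qed
  then show "concyclic ((\<lambda>i. q i \<diamondop> p i) ` ?I)"
    unfolding concyclic_def using M(1) by blast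
qed

end

theorem theorem4p1:
  fixes P :: "'a set" and \<Lambda> \<Sigma>\<^sub>1 \<Sigma>\<^sub>2 :: "'a set set"
  assumes "symmetric_minkowski_plane P \<Lambda> \<Sigma>\<^sub>1 \<Sigma>\<^sub>2"
  shows "hyperbola_structure.rectangle_axiom P \<Lambda> \<Sigma>\<^sub>1 \<Sigma>\<^sub>2"
proof -
  interpret symmetric_minkowski_plane P \<Lambda> \<Sigma>\<^sub>1 \<Sigma>\<^sub>2 by (fact assms)
  \<comment> \<open>Any circle can serve as the base of the coordinates.\<close>
  obtain E where "E \<in> \<Lambda>" using nonempty by blast
  then interpret based_plane P \<Lambda> \<Sigma>\<^sub>1 \<Sigma>\<^sub>2 E by unfold_locales
  show ?thesis by (fact rectangle)
qed

end
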